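(* Let $G=(V,E)$ be a directed graph, let $e\in E$, and let $\Sigma\in\mathcal{M}^{p}_{G,e}$. Then $$\Sigma\in\mathcal{M}^{0}_{G,e}\iff \text{the sign of } e \text{ is non-identifiable for } \Sigma .$$
   Context: Let $PD_d$ be the set of symmetric positive definite real $d\times d$ matrices and $PDD_d\subset PD_d$ the set of diagonal ones. $G=(V,E)$ is a finite directed graph with $V=\{V_1,\dots,V_d\}$; cycles and self-loops are allowed. $\operatorname{An}_G(V_i)$ is the set of all $V_k$ from which there is a directed path with at least one edge to $V_i$ (so $V_i\in \operatorname{An}_G(V_i)$ iff $V_i$ lies on a directed cycle, a self-loop counting as a cycle). For $A\in\mathbb{R}^{d\times d}$ the entry $A_{ij}$ corresponds to the edge $e=(V_j,V_i)$, i.e. $V_j\to V_i$, and we write $A_e:=A_{ij}$; $\operatorname{supp}(A)$ is the set of edges $(V_j,V_i)$ with $A_{ij}\neq 0$. The set of $t$-faithful covariance matrices is $$F_G:=\{\Sigma\in PD_d:\ \forall V_i,V_j\in V,\ \operatorname{An}_G(V_i)\cap\operatorname{An}_G(V_j)=\emptyset\iff\Sigma_{ij}=0\}.$$ For $k\in\{+,-\}$, $$\mathcal{M}^{k}_{G,e}:=\{\Sigma\in F_G:\exists A\in\mathbb{R}^{d\times d},\,D\in PDD_d \text{ with } A\Sigma+\Sigma A^T=-D,\ \operatorname{supp}(A)=E,\ \operatorname{sign}(A_e)=k\},$$ $$\mathcal{M}^{0}_{G,e}:=\{\Sigma\in F_G:\exists A\in\mathbb{R}^{d\times d},\,D\in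 PDD_d \text{ with } A\Sigma+\Sigma A^T=-D,\ \operatorname{supp}(A)\subset E,\ \operatorname{sign}(A_e)=0\},$$ and $\mathcal{M}^{p}_{G,e}:=\mathcal{M}^{+}_{G,e}\cup\mathcal{M}^{-}_{G,e}$. For $\Sigma\in\mathcal{M}^p_{G,e}$, the sign of $e$ is called non-identifiable for $\Sigma$ if $\Sigma\in\mathcal{M}^{+}_{G,e}\cap\mathcal{M}^{-}_{G,e}$, and identifiable for $\Sigma$ otherwise. *)

theory Defs
  imports "HOL-Analysis.Analysis"
begin

(* A graph on V_1, ..., V_d is given by its edge set E over the finite vertex type 'n
   (d = CARD('n)); the pair (j, i) in E is the edge from V_j to V_i.  Vertices also index
   the rows and columns of the matrices. *)

definition pos_def_mats :: "(real^'n^'n) set" where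
  "pos_def_mats = {S. transpose S = S \<and> (\<forall>x. x \<noteq> 0 \<longrightarrow> 0 < x \<bullet> (S *v x))}"

definition pos_def_diag_mats :: "(real^'n^'n) set" where
  "pos_def_diag_mats = {D \<in> pos_def_mats. \<forall>i j. i \<noteq> j \<longrightarrow> D $ i $ j = 0}"

(* The transitive closure is deliberately not reflexive: a vertex is its own ancestor
   iff it lies on a directed cycle or has a self-loop. *)
definition ancestors :: "('n \<times> 'n) set \<Rightarrow> 'n \<Rightarrow> 'n set" where
  "ancestors E i = {k. (k, i) \<in> E\<^sup>+}"

(* The edge (j, i) corresponds to row i, column j. *)
definition edge_entry :: "real^'n^'n \<Rightarrow> 'n \<times> 'n \<Rightarrow> real" where
  "edge_entry A e = A $ snd e $ fst e"

definition mat_supp :: "real^'n^'n \<Rightarrow> ('n \<times> 'n) set" where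
  "mat_supp A = {e. edge_entry A e \<noteq> 0}"

definition faithful_covs :: "('n::finite \<times> 'n) set \<Rightarrow> (real^'n^'n) set" where
  "faithful_covs E = {S \<in> pos_def_mats.
     \<forall>i j. ancestors E i \<inter> ancestors E j = {} \<longleftrightarrow> S $ i $ j = 0}"

definition lyapunov_eq :: "real^'n^'n \<Rightarrow> real^'n^'n \<Rightarrow> real^'n^'n \<Rightarrow> bool" where
  "lyapunov_eq A S D \<longleftrightarrow> A ** S + S ** transpose A = - D"

definition M_plus :: "('n::finite \<times> 'n) set \<Rightarrow> 'n \<times> 'n \<Rightarrow> (real^'n^'n) set" where
  "M_plus E e = {S \<in> faithful_covs E. \<exists>A. \<exists>D \<in> pos_def_diag_mats.
     lyapunov_eq A S D \<and> mat_supp A = E \<and> sgn (edge_entry A e) = 1}"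

definition M_minus :: "('n::finite \<times> 'n) set \<Rightarrow> 'n \<times> 'n \<Rightarrow> (real^'n^'n) set" where
  "M_minus E e = {S \<in> faithful_covs E. \<exists>A. \<exists>D \<in> pos_def_diag_mats.
     lyapunov_eq A S D \<and> mat_supp A = E \<and> sgn (edge_entry A e) = -1}"

(* Unlike in M_plus and M_minus, the support need only be contained in E. *)
definition M_zero :: "('n::finite \<times> 'n) set \<Rightarrow> 'n \<times> 'n \<Rightarrow> (real^'n^'n) set" where
  "M_zero E e = {S \<in> faithful_covs E. \<exists>A. \<exists>D \<in> pos_def_diag_mats.
     lyapunov_eq A S D \<and> mat_supp A \<subseteq> E \<and> sgn (edge_entry A e) = 0}"

definition M_p :: "('n::finite \<times> 'n) set \<Rightarrow> 'n \<times> 'n \<Rightarrow> (real^'n^'n) set" where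
  "M_p E e = M_plus E e \<union> M_minus E e"

definition sign_non_identifiable ::
    "('n::finite \<times> 'n) set \<Rightarrow> 'n \<times> 'n \<Rightarrow> real^'n^'n \<Rightarrow> bool" where
  "sign_non_identifiable E e S \<longleftrightarrow> S \<in> M_plus E e \<inter> M_minus E e"

end

theory Submission
  imports Defs
begin

text \<open>
  For fixed \<open>\<Sigma>\<close> the Lyapunov equation is linear in the pair \<open>(A, D)\<close>, so its solutions can be
  combined linearly as long as the right-hand side stays positive.  If the sign of \<open>A\<^sub>e\<close> can be
  both \<open>+\<close> and \<open>-\<close>, the segment between the two solutions crosses \<open>A\<^sub>e = 0\<close>
  (\<open>M_plus_Int_M_minus_subset_M_zero\<close>).  Conversely, let \<open>(A\<^sub>0, D\<^sub>0)\<close> solve the equation with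
  \<open>A\<^sub>e = 0\<close> and let \<open>(A, D)\<close> solve it with full support \<open>E\<close>.  Positive definite diagonal matrices
  are open among the diagonal ones, so from \<open>(A\<^sub>0, D\<^sub>0)\<close> a small step in the direction
  \<open>-(A, D)\<close> is allowed as well.  It restores the support to \<open>E\<close> and makes the sign of the entry at
  \<open>e\<close> opposite to the one in \<open>A\<close> (\<open>flip_edge_sign\<close>).
\<close>

lemma edge_entry_lincomb:
  "edge_entry (a *\<^sub>R A + b *\<^sub>R B) e = a * edge_entry A e + b * edge_entry B e"
  by (simp add: edge_entry_def)

lemma lyapunov_eq_lincomb:
  fixes A B S C D :: "real^'n^'n"
  assumes "lyapunov_eq A S C" "lyapunov_eq B S D"
  shows "lyapunov_eq (a *\<^sub>R A + b *\<^sub>R B) S (a *\<^sub>R C + b *\<^sub>R D)"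
proof -
  have add: "(M + N) ** S = M ** S + N ** S" for M N
    by (simp add: vec_eq_iff matrix_matrix_mult_def sum.distrib distrib_right)
  have transpose: "transpose (a *\<^sub>R A + b *\<^sub>R B) = a *\<^sub>R transpose A + b *\<^sub>R transpose B"
    by (simp add: transpose_def vec_eq_iff)
  have "(a *\<^sub>R A + b *\<^sub>R B) ** S + S ** transpose (a *\<^sub>R A + b *\<^sub>R B)
      = a *\<^sub>R (A ** S + S ** transpose A) + b *\<^sub>R (B ** S + S ** transpose B)"
    unfolding transpose add matrix_add_ldistrib matrix_scalar_ac scalar_matrix_assoc[symmetric]
    by (simp add: scaleR_add_right)
  also have "\<dots> = - (a *\<^sub>R C + b *\<^sub>R D)"
    using assms by (simp add: lyapunov_eq_def)
  finally show ?thesis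
    by (simp add: lyapunov_eq_def)
qed

lemma mat_supp_lincomb_subset:
  "mat_supp (a *\<^sub>R A + b *\<^sub>R B) \<subseteq> mat_supp A \<union> mat_supp B"
  by (auto simp: mat_supp_def edge_entry_lincomb)

text \<open>The quadratic form of a diagonal matrix is \<open>\<Sum>\<^sub>i D\<^sub>i\<^sub>i x\<^sub>i\<^sup>2\<close>.  This turns definiteness into
  finitely many strict inequalities, which positive combinations and small perturbations
  preserve.\<close>

lemma pos_def_diag_mats_iff:
  fixes D :: "real^'n^'n"
  shows "D \<in> pos_def_diag_mats \<longleftrightarrow> (\<forall>i j. i \<noteq> j \<longrightarrow> D $ i $ j = 0) \<and> (\<forall>i. 0 < D $ i $ i)"
    (is "_ \<longleftrightarrow> ?diag \<and> ?pos")
proof (cases ?diag)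
  case True
  have entry: "D $ i $ j = (if j = i then D $ i $ i else 0)" for i j
    using True by auto
  have form: "x \<bullet> (D *v x) = (\<Sum>i\<in>UNIV. D $ i $ i * (x $ i)\<^sup>2)" for x
  proof -
    have "(D *v x) $ i = D $ i $ i * x $ i" for i
      unfolding matrix_vector_mult_def
      by (subst entry) (simp add: if_distrib[of "\<lambda>c. c * _"] cong: if_cong)
    then show ?thesis
      by (simp add: inner_vec_def power2_eq_square mult_ac)
  qed
  have "transpose D = D"
    using True by (auto simp: transpose_def vec_eq_iff) (metis)
  moreover have "0 < D $ i $ i" if "\<forall>x. x \<noteq> 0 \<longrightarrow> 0 < x \<bullet> (D *v x)" for i
  proof -
    have "0 < axis i 1 \<bullet> (D *v axis i 1)"
      using that by (simp add: axis_eq_0_iff)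
    also have "\<dots> = (\<Sum>j\<in>UNIV. if j = i then D $ j $ j else 0)"
      unfolding form by (rule sum.cong) (auto simp: axis_def)
    finally have "0 < (\<Sum>j\<in>UNIV. if j = i then D $ j $ j else 0)" .
    then show ?thesis
      by simp
  qed
  moreover have "0 < x \<bullet> (D *v x)" if pos: ?pos and "x \<noteq> 0" for x
  proof -
    obtain i where "x $ i \<noteq> 0"
      using \<open>x \<noteq> 0\<close> by (auto simp: vec_eq_iff)
    with pos have "0 < (\<Sum>i\<in>UNIV. D $ i $ i * (x $ i)\<^sup>2)"
      by (intro sum_pos2[of _ i]) (auto simp: less_imp_le)
    then show ?thesis
      by (simp add: form)
  qed
  ultimately have "D \<in> pos_def_mats \<longleftrightarrow> ?pos"
    unfolding pos_def_mats_def mem_Collect_eq by (intro iffI allI impI conjI) simp_all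
  with True show ?thesis
    by (simp add: pos_def_diag_mats_def)
next
  case False
  then show ?thesis
    by (auto simp: pos_def_diag_mats_def)
qed

lemma pos_def_diag_mats_pos_lincomb:
  assumes "C \<in> pos_def_diag_mats" "D \<in> pos_def_diag_mats" "0 < a" "0 < b"
  shows "a *\<^sub>R C + b *\<^sub>R D \<in> pos_def_diag_mats"
  using assms by (simp add: pos_def_diag_mats_iff add_pos_pos)

lemma eventually_pos_at_right_0:
  fixes p q :: real
  assumes "0 < p"
  shows "\<forall>\<^sub>F t in at_right 0. 0 < p - t * q"
proof -
  have "((\<lambda>t. p - t * q) \<longlongrightarrow> p - 0 * q) (at_right 0)"
    by (intro tendsto_intros)
  then show ?thesis
    by (rule order_tendstoD) (use assms in simp)
qed

text \<open>A small step keeps the nonzero entries of \<open>p\<close> nonzero by continuity, and an entry \<open>p = 0\<close>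
  becomes \<open>- t * q\<close>.  The step therefore fills the whole support at once.\<close>

lemma eventually_nonzero_at_right_0:
  fixes p q :: real
  assumes "q \<noteq> 0"
  shows "\<forall>\<^sub>F t in at_right 0. p - t * q \<noteq> 0"
proof (cases "p = 0")
  case True
  then show ?thesis
    using assms eventually_at_right_less[of "0::real"] by (auto elim: eventually_mono)
next
  case False
  have "((\<lambda>t. p - t * q) \<longlongrightarrow> p - 0 * q) (at_right 0)"
    by (intro tendsto_intros)
  then show ?thesis
    using False by (intro tendsto_imp_eventually_ne) auto
qed

lemma eventually_diff_in_pos_def_diag_mats:
  assumes "C \<in> pos_def_diag_mats" "D \<in> pos_def_diag_mats"
  shows "\<forall>\<^sub>F t in at_right 0. 1 *\<^sub>R C + (- t) *\<^sub>R D \<in> pos_def_diag_mats"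
proof -
  have "\<forall>\<^sub>F t in at_right 0. \<forall>i. 0 < C $ i $ i - t * D $ i $ i"
    using assms by (intro eventually_all_finite eventually_pos_at_right_0)
      (simp add: pos_def_diag_mats_iff)
  then show ?thesis
    by eventually_elim (use assms in \<open>simp add: pos_def_diag_mats_iff\<close>)
qed

lemma eventually_mat_supp_diff:
  fixes A B :: "real^'n^'n"
  assumes "mat_supp A \<subseteq> mat_supp B"
  shows "\<forall>\<^sub>F t in at_right 0. mat_supp (1 *\<^sub>R A + (- t) *\<^sub>R B) = mat_supp B"
proof -
  have "\<forall>\<^sub>F t in at_right 0. \<forall>f\<in>mat_supp B. edge_entry A f - t * edge_entry B f \<noteq> 0"
    by (intro eventually_ball_finite ballI eventually_nonzero_at_right_0)
      (auto simp: mat_supp_def)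
  then show ?thesis
  proof eventually_elim
    case (elim t)
    then have "mat_supp B \<subseteq> mat_supp (1 *\<^sub>R A + (- t) *\<^sub>R B)"
      unfolding mat_supp_def[of "1 *\<^sub>R A + (- t) *\<^sub>R B"] edge_entry_lincomb by auto
    with mat_supp_lincomb_subset[of 1 A "- t" B] assms show ?case
      by blast
  qed
qed

text \<open>The matrix sought is \<open>A\<^sub>0 - t A\<close> for small \<open>t > 0\<close>: its entry at \<open>e\<close> is \<open>- t A\<^sub>e\<close>.\<close>

lemma flip_edge_sign:
  fixes A\<^sub>0 A S D\<^sub>0 D :: "real^'n^'n"
  assumes "lyapunov_eq A\<^sub>0 S D\<^sub>0" "D\<^sub>0 \<in> pos_def_diag_mats"
    and "mat_supp A\<^sub>0 \<subseteq> mat_supp A" "edge_entry A\<^sub>0 e = 0"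
    and "lyapunov_eq A S D" "D \<in> pos_def_diag_mats"
  shows "\<exists>B. \<exists>C\<in>pos_def_diag_mats. lyapunov_eq B S C \<and> mat_supp B = mat_supp A
           \<and> sgn (edge_entry B e) = - sgn (edge_entry A e)"
proof -
  have "\<forall>\<^sub>F t::real in at_right 0. 0 < t
      \<and> 1 *\<^sub>R D\<^sub>0 + (- t) *\<^sub>R D \<in> pos_def_diag_mats
      \<and> mat_supp (1 *\<^sub>R A\<^sub>0 + (- t) *\<^sub>R A) = mat_supp A"
    using assms by (intro eventually_conj eventually_at_right_less
        eventually_diff_in_pos_def_diag_mats eventually_mat_supp_diff)
  then obtain t :: real where t: "0 < t"
      "1 *\<^sub>R D\<^sub>0 + (- t) *\<^sub>R D \<in> pos_def_diag_mats"
      "mat_supp (1 *\<^sub>R A\<^sub>0 + (- t) *\<^sub>R A) = mat_supp A"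
    using eventually_happens'[OF trivial_limit_at_right_real] by blast
  have "sgn (edge_entry (1 *\<^sub>R A\<^sub>0 + (- t) *\<^sub>R A) e) = - sgn (edge_entry A e)"
    unfolding edge_entry_lincomb using assms(4) t(1) by (simp add: sgn_mult)
  with t lyapunov_eq_lincomb[OF assms(1,5)] show ?thesis
    by blast
qed

text \<open>The point \<open>q A + p B\<close>, for \<open>A\<^sub>e = p > 0\<close> and \<open>B\<^sub>e = -q < 0\<close>, is up to scaling where the
  segment from \<open>A\<close> to \<open>B\<close> meets \<open>A\<^sub>e = 0\<close>.  Other entries may cancel there too; the inclusion of
  supports in \<open>M_zero\<close> absorbs this.\<close>

lemma M_plus_Int_M_minus_subset_M_zero: "M_plus E e \<inter> M_minus E e \<subseteq> M_zero E e"
proof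
  fix S
  assume S: "S \<in> M_plus E e \<inter> M_minus E e"
  then obtain A C where A: "C \<in> pos_def_diag_mats" "lyapunov_eq A S C" "mat_supp A = E"
      "sgn (edge_entry A e) = 1"
    by (auto simp: M_plus_def)
  from S obtain B D where B: "D \<in> pos_def_diag_mats" "lyapunov_eq B S D" "mat_supp B = E"
      "sgn (edge_entry B e) = -1"
    by (auto simp: M_minus_def)
  define p q where "p = edge_entry A e" and "q = - edge_entry B e"
  have pos: "0 < p" "0 < q"
    using A(4) B(4) by (simp_all add: p_def q_def sgn_1_pos sgn_1_neg)
  have "q *\<^sub>R C + p *\<^sub>R D \<in> pos_def_diag_mats"
    using A(1) B(1) pos by (intro pos_def_diag_mats_pos_lincomb)
  moreover have "lyapunov_eq (q *\<^sub>R A + p *\<^sub>R B) S (q *\<^sub>R C + p *\<^sub>R D)"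
    using A(2) B(2) by (rule lyapunov_eq_lincomb)
  moreover have "mat_supp (q *\<^sub>R A + p *\<^sub>R B) \<subseteq> E"
    using mat_supp_lincomb_subset[of q A p B] A(3) B(3) by blast
  moreover have "sgn (edge_entry (q *\<^sub>R A + p *\<^sub>R B) e) = 0"
    unfolding edge_entry_lincomb p_def q_def by simp
  moreover have "S \<in> faithful_covs E"
    using S by (simp add: M_plus_def)
  ultimately show "S \<in> M_zero E e"
    unfolding M_zero_def by blast
qed

theorem theorem4p2:
  fixes E :: "('n::finite \<times> 'n) set"
    and e :: "'n \<times> 'n"
    and \<Sigma> :: "real^'n^'n"
  assumes "e \<in> E"
    and "\<Sigma> \<in> M_p E e"
  shows "\<Sigma> \<in> M_zero E e \<longleftrightarrow> sign_non_identifiable E e \<Sigma>"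
proof
  assume "\<Sigma> \<in> M_zero E e"
  then obtain A\<^sub>0 D\<^sub>0 where zero: "lyapunov_eq A\<^sub>0 \<Sigma> D\<^sub>0" "D\<^sub>0 \<in> pos_def_diag_mats"
      "mat_supp A\<^sub>0 \<subseteq> E" "edge_entry A\<^sub>0 e = 0"
    by (auto simp: M_zero_def sgn_zero_iff)
  have flip: "\<exists>B. \<exists>C\<in>pos_def_diag_mats. lyapunov_eq B \<Sigma> C \<and> mat_supp B = E
      \<and> sgn (edge_entry B e) = - sgn (edge_entry A e)"
    if "lyapunov_eq A \<Sigma> D" "D \<in> pos_def_diag_mats" "mat_supp A = E" for A D
    using flip_edge_sign[of A\<^sub>0 \<Sigma> D\<^sub>0 A e D] zero that by simp
  have "\<Sigma> \<in> M_minus E e" if "\<Sigma> \<in> M_plus E e"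
    using that flip unfolding M_plus_def M_minus_def by fastforce
  moreover have "\<Sigma> \<in> M_plus E e" if "\<Sigma> \<in> M_minus E e"
    using that flip unfolding M_plus_def M_minus_def by fastforce
  ultimately show "sign_non_identifiable E e \<Sigma>"
    using assms(2) by (auto simp: M_p_def sign_non_identifiable_def)
next
  assume "sign_non_identifiable E e \<Sigma>"
  then show "\<Sigma> \<in> M_zero E e"
    using M_plus_Int_M_minus_subset_M_zero unfolding sign_non_identifiable_def by blast
qed

end
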